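(* There exists a function $f(z) = \sum_{n=0}^\infty a_n z^n$ analytic on $\mathbb{C}$ such that: (1) $a_n \in [-1,1]$ for every $n \geq 0$; (2) the sequence $(a_n)_{n \geq 0}$ contains arbitrarily long strings of (consecutive) negative numbers; (3) for every tree $G$, $f_G[A] \in \mathbb{P}_G$ for every $A \in \mathbb{P}_G([0,\infty))$. In particular, there exist a family $(G_n)_{n\ge 1}$ of graphs and an analytic function $f$ that is not absolutely monotonic, such that: (1) $\sup_{n \geq 1} \Delta(G_n) = \infty$; (2) $f_{G_n}[A] \in \mathbb{P}_{G_n}$ for every $n\ge 1$ and every $A \in \mathbb{P}_{G_n}([0,\infty))$.
   Context: All graphs $G=(V,E)$ are finite, undirected, with no self-loops, with vertex set $V=\{1,\dots,n\}$ and $|G|:=|V|$; $\Delta(G)$ denotes the maximum degree of the vertices of $G$. For $I \subset \mathbb{R}$, $\mathbb{S}_n(I)$ is the set of real symmetric $n\times n$ matrices with entries in $I$, and $\mathbb{P}_n(I)$ is the set of positive semidefinite matrices in $\mathbb{S}_n(I)$. Define $\mathbb{S}_G(I) := \{A \in \mathbb{S}_{|G|}(I) : a_{ij} = 0 \text{ for every } (i,j)\notin E,\ i\neq j\}$ and $\mathbb{P}_G(I) := \mathbb{P}_{|G|}(I)\cap \mathbb{S}_G(I)$; write $\mathbb{P}_G := \mathbb{P}_G(\mathbb{R})$. For a function $f: I \to \mathbb{R}$ and $A\in \mathbb{S}_{|G|}(I)$, $f_G[A]$ is the matrix with $(i,j)$ entry $f(a_{ij})$ if $(i,j)\in E$ or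 $i=j$, and $0$ otherwise. A continuous function $f$ on an interval $I$ with interior $I^\circ$ is absolutely monotonic on $I$ if it is $C^\infty$ on $I^\circ$ and $f^{(k)}(x)\ge 0$ for every $x\in I^\circ$ and every $k\ge 0$; here the relevant interval is $[0,\infty)$. *)

theory Defs
  imports
    "HOL-Complex_Analysis.Complex_Analysis"
    "HOL-Library.Extended_Nat"
    "Jordan_Normal_Form.Matrix"
    "Graph_Theory.Digraph_Component"
begin

section \<open>Graphs and trees\<close>

text \<open>
  An undirected simple graph is a finite, loop-free, symmetric relation on its vertices
  (locale \<^locale>\<open>pair_graph\<close>). The \<open>n\<close> vertices are labelled \<open>0, \<dots>, n - 1\<close> rather than
  \<open>1, \<dots>, n\<close>, to agree with the indexing of matrix rows and columns.
\<close>

definition labelled_graph :: "nat pair_pre_digraph \<Rightarrow> bool" where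
  "labelled_graph G \<longleftrightarrow> pair_graph G \<and> (\<exists>n>0. pverts G = {0..<n})"

definition graph_size :: "nat pair_pre_digraph \<Rightarrow> nat" where
  "graph_size G = card (pverts G)"

definition max_degree :: "nat pair_pre_digraph \<Rightarrow> nat" where
  "max_degree G = Max (out_degree (with_proj G) ` pverts G)"

text \<open>
  The constant \<^const>\<open>Digraph_Component.tree\<close> speaks about directed cycles, so that the walk \<open>u, v, u\<close> along a
  single undirected edge already counts as a cycle. A cycle of an undirected simple graph
  is a directed cycle of length at least three.
\<close>

definition undirected_tree :: "nat pair_pre_digraph \<Rightarrow> bool" where
  "undirected_tree G \<longleftrightarrow> labelled_graph G \<and> Digraph_Component.connected (with_proj G) \<and>
     \<not> (\<exists>p. pre_digraph.cycle (with_proj G) p \<and> 3 \<le> length p)"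


section \<open>Matrices with a given sparsity pattern\<close>

definition sym_mats :: "nat \<Rightarrow> real set \<Rightarrow> real mat set" where
  "sym_mats n I = {A \<in> carrier_mat n n. transpose_mat A = A \<and> (\<forall>i<n. \<forall>j<n. A $$ (i, j) \<in> I)}"

definition psd_mats :: "nat \<Rightarrow> real set \<Rightarrow> real mat set" where
  "psd_mats n I = {A \<in> sym_mats n I. \<forall>x \<in> carrier_vec n. 0 \<le> scalar_prod x (A *\<^sub>v x)}"

definition graph_sym_mats :: "nat pair_pre_digraph \<Rightarrow> real set \<Rightarrow> real mat set" where
  "graph_sym_mats G I = {A \<in> sym_mats (graph_size G) I.
     \<forall>i<graph_size G. \<forall>j<graph_size G. (i, j) \<notin> parcs G \<and> i \<noteq> j \<longrightarrow> A $$ (i, j) = 0}"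

definition graph_psd_mats :: "nat pair_pre_digraph \<Rightarrow> real set \<Rightarrow> real mat set" where
  "graph_psd_mats G I = psd_mats (graph_size G) I \<inter> graph_sym_mats G I"

definition graph_entrywise ::
    "nat pair_pre_digraph \<Rightarrow> (real \<Rightarrow> real) \<Rightarrow> real mat \<Rightarrow> real mat" where
  "graph_entrywise G f A = mat (graph_size G) (graph_size G)
     (\<lambda>(i, j). if (i, j) \<in> parcs G \<or> i = j then f (A $$ (i, j)) else 0)"


section \<open>Absolutely monotonic functions\<close>

definition absolutely_monotonic_on :: "real set \<Rightarrow> (real \<Rightarrow> real) \<Rightarrow> bool" where
  "absolutely_monotonic_on I f \<longleftrightarrow> continuous_on I f \<and>
     (\<forall>k. \<forall>x \<in> interior I. (deriv ^^ k) f field_differentiable (at x)) \<and>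
     (\<forall>k. \<forall>x \<in> interior I. 0 \<le> (deriv ^^ k) f x)"

end

theory Submission
  imports Defs "HOL-Library.Discrete_Functions"
begin

text \<open>
  Two inequalities on \<open>[0, \<infinity>)\<close> make the entrywise application of a nonnegative function \<open>f\<close>
  harmless on every forest: superadditivity \<open>f x + f y \<le> f (x + y)\<close>, and multiplicative midpoint
  convexity \<open>(f (u v))\<^sup>2 \<le> f (u\<^sup>2) f (v\<^sup>2)\<close>. Indeed, let \<open>w\<close> be a leaf with neighbour \<open>p\<close> and
  \<open>a w w > 0\<close>. Eliminating \<open>w\<close> by a Schur complement only lowers the diagonal entry \<open>a p p\<close> by
  \<open>t = (a w p)\<^sup>2 / a w w\<close>, and eliminating \<open>w\<close> from the transformed matrix lowers \<open>f (a p p)\<close> by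
  \<open>(f (a w p))\<^sup>2 / f (a w w)\<close> when \<open>f (a w w) > 0\<close>. Since \<open>a w p\<close> is the geometric mean of \<open>t\<close> and \<open>a w w\<close>, this loss is
  at most \<open>f t\<close> by convexity, hence at most \<open>f (a p p) - f (a p p - t)\<close> by superadditivity. So
  induction on the number of vertices applies to the smaller matrix (\<open>forest_entrywise_psd\<close>).

  Neither inequality forces nonnegative Taylor coefficients. For coefficients \<open>b\<close>, the defect of
  convexity is one half of \<open>\<Sum>i j. b i b j (u\<^sup>i v\<^sup>j - u\<^sup>j v\<^sup>i)\<^sup>2\<close> (\<open>mid_convexity_defect\<close>). The exponent
  pairs \<open>(i, j)\<close> with \<open>0 \<le> i < j < D\<close> fill the triangle with corners \<open>(0, 1)\<close>, \<open>(0, D - 1)\<close> and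
  \<open>(D - 2, D - 1)\<close>, so the three corner squares dominate all the others up to a factor of order
  \<open>D\<^sup>2\<close> (\<open>swapped_monomials_dominated\<close>). A polynomial of degree \<open>D - 1\<close> whose first two and
  last two coefficients are \<open>1\<close> therefore tolerates small negative coefficients everywhere in
  between, and the same corners keep it nondecreasing; multiplying by a positive power of \<open>x\<close> then
  gives superadditivity. Placing such a block on the exponents \<open>2\<^sup>k, \<dots>, 2\<^sup>k\<^sup>+\<^sup>1 - 1\<close> for each \<open>k \<ge> 2\<close>,
  with rapidly decaying weights, yields an entire function with arbitrarily long runs of negative
  coefficients. Both inequalities survive sums and pointwise limits, so they pass to it from the
  blocks.

  Stars are forests of unbounded degree, and a nonnegative \<open>m\<close>-th derivative on \<open>(0, \<infinity>)\<close> would by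
  continuity force the \<open>m\<close>-th coefficient to be nonnegative. This gives the second half.
\<close>

section \<open>Multiplicatively convex superadditive functions\<close>

text \<open>
  Convexity is stated with the arguments \<open>u\<^sup>2\<close> and \<open>v\<^sup>2\<close> so that their geometric mean is \<open>u v\<close>: for
  power series everything stays polynomial in \<open>u\<close> and \<open>v\<close>.
\<close>

definition mult_convex_superadditive :: "(real \<Rightarrow> real) \<Rightarrow> bool" where
  "mult_convex_superadditive f \<longleftrightarrow>
     (\<forall>x\<ge>0. 0 \<le> f x) \<and>
     (\<forall>u\<ge>0. \<forall>v\<ge>0. (f (u * v))\<^sup>2 \<le> f (u\<^sup>2) * f (v\<^sup>2)) \<and>
     (\<forall>x\<ge>0. \<forall>y\<ge>0. f x + f y \<le> f (x + y))"

lemma mult_convex_superadditiveD: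
  assumes "mult_convex_superadditive f"
  shows "x \<ge> 0 \<Longrightarrow> 0 \<le> f x"
    and "u \<ge> 0 \<Longrightarrow> v \<ge> 0 \<Longrightarrow> (f (u * v))\<^sup>2 \<le> f (u\<^sup>2) * f (v\<^sup>2)"
    and "x \<ge> 0 \<Longrightarrow> y \<ge> 0 \<Longrightarrow> f x + f y \<le> f (x + y)"
    and "f 0 = 0"
proof -
  show nonneg: "x \<ge> 0 \<Longrightarrow> 0 \<le> f x" for x
    using assms by (simp add: mult_convex_superadditive_def)
  show "u \<ge> 0 \<Longrightarrow> v \<ge> 0 \<Longrightarrow> (f (u * v))\<^sup>2 \<le> f (u\<^sup>2) * f (v\<^sup>2)"
    using assms by (simp add: mult_convex_superadditive_def)
  show super: "x \<ge> 0 \<Longrightarrow> y \<ge> 0 \<Longrightarrow> f x + f y \<le> f (x + y)" for x y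
    using assms by (simp add: mult_convex_superadditive_def)
  show "f 0 = 0"
    using nonneg[of 0] super[of 0 0] by simp
qed

text \<open>
  The Cauchy--Schwarz inequality for \<open>(\<surd>a, \<surd>c)\<close> and \<open>(\<surd>b, \<surd>d)\<close>, which makes convexity in the
  multiplicative sense stable under addition.
\<close>

lemma mult_cauchy_schwarz:
  fixes a b c d F G :: real
  assumes nonneg: "0 \<le> a" "0 \<le> b" "0 \<le> c" "0 \<le> d"
    and F: "F\<^sup>2 \<le> a * b" and G: "G\<^sup>2 \<le> c * d"
  shows "(F + G)\<^sup>2 \<le> (a + c) * (b + d)"
proof -
  have "(2 * F * G)\<^sup>2 = 4 * (F\<^sup>2 * G\<^sup>2)"
    by (simp add: power_mult_distrib)
  moreover have "F\<^sup>2 * G\<^sup>2 \<le> (a * b) * (c * d)"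
    using F G nonneg by (intro mult_mono) auto
  moreover have "4 * ((a * b) * (c * d)) = (a * d + b * c)\<^sup>2 - (a * d - b * c)\<^sup>2"
    by (simp add: power2_eq_square algebra_simps)
  ultimately have "(2 * F * G)\<^sup>2 \<le> (a * d + b * c)\<^sup>2"
    using zero_le_power2[of "a * d - b * c"] by linarith
  then have "2 * F * G \<le> a * d + b * c"
    by (rule power2_le_imp_le) (use nonneg in simp)
  then show ?thesis
    using F G by (simp add: power2_eq_square algebra_simps)
qed

lemma mult_convex_superadditive_add:
  assumes f: "mult_convex_superadditive f" and g: "mult_convex_superadditive g"
  shows "mult_convex_superadditive (\<lambda>x. f x + g x)"
proof -
  have "(f (u * v) + g (u * v))\<^sup>2 \<le> (f (u\<^sup>2) + g (u\<^sup>2)) * (f (v\<^sup>2) + g (v\<^sup>2))"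
    if "u \<ge> 0" "v \<ge> 0" for u v
    using f g that unfolding mult_convex_superadditive_def
    by (intro mult_cauchy_schwarz) auto
  moreover have "f x + g x + (f y + g y) \<le> f (x + y) + g (x + y)" if "x \<ge> 0" "y \<ge> 0" for x y
  proof -
    have "f x + f y \<le> f (x + y)" "g x + g y \<le> g (x + y)"
      using f g that unfolding mult_convex_superadditive_def by auto
    then show ?thesis by simp
  qed
  moreover have "0 \<le> f x + g x" if "x \<ge> 0" for x
    using f g that unfolding mult_convex_superadditive_def by simp
  ultimately show ?thesis
    unfolding mult_convex_superadditive_def by blast
qed

text \<open>All defining conditions are non-strict inequalities between values at finitely many points.\<close>

lemma mult_convex_superadditive_limit:
  assumes F: "\<And>k. mult_convex_superadditive (F k)"
    and lim: "\<And>x. x \<ge> 0 \<Longrightarrow> (\<lambda>k. F k x) \<longlonglongrightarrow> f x"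
  shows "mult_convex_superadditive f"
  unfolding mult_convex_superadditive_def
proof (intro conjI allI impI)
  fix x :: real assume x: "x \<ge> 0"
  have "\<And>k. 0 \<le> F k x"
    using F x by (simp add: mult_convex_superadditive_def)
  then show "0 \<le> f x"
    by (intro LIMSEQ_le_const[OF lim[OF x]]) blast
next
  fix u v :: real assume u: "u \<ge> 0" and v: "v \<ge> 0"
  have "\<And>k. (F k (u * v))\<^sup>2 \<le> F k (u\<^sup>2) * F k (v\<^sup>2)"
    using F u v by (simp add: mult_convex_superadditive_def)
  moreover have "(\<lambda>k. (F k (u * v))\<^sup>2) \<longlonglongrightarrow> (f (u * v))\<^sup>2"
    using u v by (intro tendsto_power lim) simp
  moreover have "(\<lambda>k. F k (u\<^sup>2) * F k (v\<^sup>2)) \<longlonglongrightarrow> f (u\<^sup>2) * f (v\<^sup>2)"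
    by (intro tendsto_mult lim) simp_all
  ultimately show "(f (u * v))\<^sup>2 \<le> f (u\<^sup>2) * f (v\<^sup>2)"
    using LIMSEQ_le by blast
next
  fix x y :: real assume x: "x \<ge> 0" and y: "y \<ge> 0"
  have "\<And>k. F k x + F k y \<le> F k (x + y)"
    using F x y by (simp add: mult_convex_superadditive_def)
  moreover have "(\<lambda>k. F k x + F k y) \<longlonglongrightarrow> f x + f y"
    using x y by (intro tendsto_add lim)
  moreover have "(\<lambda>k. F k (x + y)) \<longlonglongrightarrow> f (x + y)"
    using x y by (intro lim) simp
  ultimately show "f x + f y \<le> f (x + y)"
    using LIMSEQ_le by blast
qed

text \<open>
  Superadditivity comes from the extra factor: \<open>x\<^sup>N q x\<close> divided by \<open>x\<close> is still nondecreasing, and a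
  function \<open>x g x\<close> with \<open>g\<close> nondecreasing is superadditive.
\<close>

lemma mult_convex_superadditive_monomial_mult:
  fixes q :: "real \<Rightarrow> real"
  assumes N: "N \<ge> 1" and q0: "q 0 \<ge> 0"
    and mono: "\<And>x y. 0 \<le> x \<Longrightarrow> x \<le> y \<Longrightarrow> q x \<le> q y"
    and mid: "\<And>u v. 0 \<le> u \<Longrightarrow> 0 \<le> v \<Longrightarrow> (q (u * v))\<^sup>2 \<le> q (u\<^sup>2) * q (v\<^sup>2)"
    and c: "c \<ge> 0"
  shows "mult_convex_superadditive (\<lambda>x. c * (x ^ N * q x))"
proof -
  have nonneg: "q x \<ge> 0" if "x \<ge> 0" for x
    using mono[of 0 x] q0 that by simp
  obtain M where M: "N = Suc M" using N by (cases N) simp_all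
  have super: "x ^ N * q x + y ^ N * q y \<le> (x + y) ^ N * q (x + y)"
    if x: "x \<ge> 0" and y: "y \<ge> 0" for x y
  proof -
    have 1: "x \<le> x + y" "y \<le> x + y" "0 \<le> x + y" using x y by simp_all
    have "x ^ M * q x \<le> (x + y) ^ M * q (x + y)"
      using mult_mono[OF power_mono[OF 1(1) x] mono[OF x 1(1)]] nonneg[OF x]
        zero_le_power[OF 1(3)] by blast
    moreover have "y ^ M * q y \<le> (x + y) ^ M * q (x + y)"
      using mult_mono[OF power_mono[OF 1(2) y] mono[OF y 1(2)]] nonneg[OF y]
        zero_le_power[OF 1(3)] by blast
    ultimately have "x * (x ^ M * q x) + y * (y ^ M * q y)
        \<le> x * ((x + y) ^ M * q (x + y)) + y * ((x + y) ^ M * q (x + y))"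
      using x y by (intro add_mono mult_left_mono)
    then show ?thesis by (simp add: M algebra_simps)
  qed
  have conv: "((u * v) ^ N * q (u * v))\<^sup>2 \<le> ((u\<^sup>2) ^ N * q (u\<^sup>2)) * ((v\<^sup>2) ^ N * q (v\<^sup>2))"
    if "u \<ge> 0" "v \<ge> 0" for u v
  proof -
    have "((u * v) ^ N * q (u * v))\<^sup>2 = (u\<^sup>2) ^ N * (v\<^sup>2) ^ N * (q (u * v))\<^sup>2"
      by (simp add: power_mult_distrib power2_eq_square)
    also have "\<dots> \<le> (u\<^sup>2) ^ N * (v\<^sup>2) ^ N * (q (u\<^sup>2) * q (v\<^sup>2))"
      using that by (intro mult_left_mono mid) auto
    finally show ?thesis by (simp add: algebra_simps)
  qed
  have "(c * ((u * v) ^ N * q (u * v)))\<^sup>2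
      \<le> c * ((u\<^sup>2) ^ N * q (u\<^sup>2)) * (c * ((v\<^sup>2) ^ N * q (v\<^sup>2)))"
    if "u \<ge> 0" "v \<ge> 0" for u v
    using mult_left_mono[OF conv[OF that], of "c\<^sup>2"]
    by (simp add: power_mult_distrib power2_eq_square algebra_simps)
  moreover have "c * (x ^ N * q x) + c * (y ^ N * q y) \<le> c * ((x + y) ^ N * q (x + y))"
    if "x \<ge> 0" "y \<ge> 0" for x y
    using mult_left_mono[OF super[OF that] c] by (simp add: algebra_simps)
  ultimately show ?thesis
    using c nonneg unfolding mult_convex_superadditive_def by auto
qed

section \<open>Polynomials with negative middle coefficients\<close>

text \<open>
  Symmetrising the double sum in \<open>i\<close> and \<open>j\<close> turns the difference into a combination of squares, in
  which negative coefficients can be weighed against positive ones.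
\<close>

lemma mid_convexity_defect:
  fixes b :: "nat \<Rightarrow> real"
  shows "2 * ((\<Sum>i<D. b i * (u\<^sup>2) ^ i) * (\<Sum>i<D. b i * (v\<^sup>2) ^ i) - (\<Sum>i<D. b i * (u * v) ^ i)\<^sup>2)
    = (\<Sum>i<D. \<Sum>j<D. b i * b j * (u ^ i * v ^ j - u ^ j * v ^ i)\<^sup>2)"
proof -
  let ?S = "\<lambda>w. \<Sum>i<D. b i * w ^ i"
  have prod: "?S x * ?S y = (\<Sum>i<D. \<Sum>j<D. b i * b j * (x ^ i * y ^ j))" for x y
    by (simp add: sum_product algebra_simps)
  have sq: "?S (u * v) ^ 2 = (\<Sum>i<D. \<Sum>j<D. b i * b j * ((u * v) ^ i * (u * v) ^ j))"
    by (simp only: power2_eq_square prod)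
  have "2 * (?S (u\<^sup>2) * ?S (v\<^sup>2) - (?S (u * v))\<^sup>2)
    = ?S (u\<^sup>2) * ?S (v\<^sup>2) + ?S (v\<^sup>2) * ?S (u\<^sup>2) - 2 * (?S (u * v))\<^sup>2"
    by (simp add: algebra_simps)
  also have "\<dots> = (\<Sum>i<D. \<Sum>j<D. b i * b j * (u ^ i * v ^ j - u ^ j * v ^ i)\<^sup>2)"
    unfolding prod sq
    by (simp add: sum_distrib_left flip: sum.distrib sum_subtractf)
      (intro sum.cong refl, simp add: algebra_simps power2_eq_square power_mult_distrib
        flip: power_mult)
  finally show ?thesis .
qed

lemma power_le_one_plus_power:
  fixes x :: real
  assumes "0 \<le> x" "k \<le> n"
  shows "x ^ k \<le> 1 + x ^ n"
proof (cases "x \<le> 1")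
  case True
  then have "x ^ k \<le> 1" using assms by (simp add: power_le_one)
  then show ?thesis using assms by (simp add: add_increasing2)
next
  case False
  then have "x ^ k \<le> x ^ n" using assms by (intro power_increasing) auto
  then show ?thesis by simp
qed

text \<open>
  After the common factor \<open>v - u\<close> is removed, every monomial \<open>u\<^sup>r v\<^sup>s\<close> that is left has both exponents
  at most \<open>E\<close>, hence is at most \<open>(1 + u\<^sup>E) (1 + v\<^sup>E)\<close>.
\<close>

lemma swapped_monomials_bound:
  fixes u v :: real
  assumes u: "0 \<le> u" and v: "0 \<le> v" and "m \<le> Suc E" "n \<le> Suc E"
  shows "\<bar>u ^ m * v ^ n - u ^ n * v ^ m\<bar> \<le> \<bar>v - u\<bar> * (real (Suc E) * ((1 + u ^ E) * (1 + v ^ E)))"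
  using assms(3,4)
proof (induction m n rule: linorder_wlog)
  case (sym a b)
  then show ?case by (simp add: abs_minus_commute)
next
  case (le m n)
  define l where "l = n - m"
  have n: "n = m + l" using le by (simp add: l_def)
  have "u ^ m * v ^ n - u ^ n * v ^ m = (u ^ m * v ^ m) * (v ^ l - u ^ l)"
    by (simp add: n power_add algebra_simps)
  also have "\<dots> = (v - u) * ((u ^ m * v ^ m) * (\<Sum>i<l. u ^ (l - Suc i) * v ^ i))"
    by (simp add: power_diff_sumr2)
  also have "(u ^ m * v ^ m) * (\<Sum>i<l. u ^ (l - Suc i) * v ^ i)
      = (\<Sum>i<l. u ^ (m + (l - Suc i)) * v ^ (m + i))"
    unfolding sum_distrib_left
  proof (intro sum.cong refl)
    fix i
    have "u ^ m * v ^ m * (u ^ (l - Suc i) * v ^ i) = (u ^ m * u ^ (l - Suc i)) * (v ^ m * v ^ i)"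
      by simp
    then show "u ^ m * v ^ m * (u ^ (l - Suc i) * v ^ i) = u ^ (m + (l - Suc i)) * v ^ (m + i)"
      by (simp only: power_add)
  qed
  finally have factor: "u ^ m * v ^ n - u ^ n * v ^ m
      = (v - u) * (\<Sum>i<l. u ^ (m + (l - Suc i)) * v ^ (m + i))" .
  have "0 \<le> (\<Sum>i<l. u ^ (m + (l - Suc i)) * v ^ (m + i))"
    using u v by (intro sum_nonneg) simp
  then have "\<bar>u ^ m * v ^ n - u ^ n * v ^ m\<bar>
      = \<bar>v - u\<bar> * (\<Sum>i<l. u ^ (m + (l - Suc i)) * v ^ (m + i))"
    unfolding factor by (simp only: abs_mult abs_of_nonneg)
  also have "\<dots> \<le> \<bar>v - u\<bar> * (\<Sum>i<l. (1 + u ^ E) * (1 + v ^ E))"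
    using u v le n
    by (intro mult_left_mono sum_mono mult_mono power_le_one_plus_power) auto
  also have "\<dots> \<le> \<bar>v - u\<bar> * (real (Suc E) * ((1 + u ^ E) * (1 + v ^ E)))"
    using u v le n by (intro mult_left_mono) (auto intro!: mult_right_mono mult_nonneg_nonneg)
  finally show ?case .
qed

text \<open>
  Each of the four monomials of \<open>(1 + u\<^sup>E) (1 + v\<^sup>E)\<close> occurs in the cofactor of \<open>v - u\<close> for one of
  three corner pairs of exponents: \<open>1\<close> for \<open>(0, 1)\<close>, \<open>u\<^sup>E\<close> and \<open>v\<^sup>E\<close> for \<open>(0, E + 1)\<close>, and \<open>u\<^sup>E v\<^sup>E\<close>
  for \<open>(E, E + 1)\<close>.
\<close>

lemma swapped_monomials_dominated:
  fixes u v :: real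
  assumes u: "0 \<le> u" and v: "0 \<le> v" and mn: "m \<le> Suc E" "n \<le> Suc E" and E: "E \<ge> 1"
  shows "(u ^ m * v ^ n - u ^ n * v ^ m)\<^sup>2
    \<le> 3 * (real (E + 2))\<^sup>2 * ((v - u)\<^sup>2 + (v ^ Suc E - u ^ Suc E)\<^sup>2
        + (u ^ E * v ^ Suc E - u ^ Suc E * v ^ E)\<^sup>2)"
proof -
  let ?a = "u ^ E" and ?b = "v ^ E" and ?r = "real (Suc E)"
  have ab: "?a \<ge> 0" "?b \<ge> 0" using u v by auto
  have "(u ^ m * v ^ n - u ^ n * v ^ m)\<^sup>2 \<le> (\<bar>v - u\<bar> * (?r * ((1 + ?a) * (1 + ?b))))\<^sup>2"
    using power_mono[OF swapped_monomials_bound[OF u v mn], of 2] by simp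
  also have "\<dots> = ?r\<^sup>2 * ((v - u)\<^sup>2 * (1 + (?a + ?b) + ?a * ?b)\<^sup>2)"
  proof -
    have "(1 + ?a) * (1 + ?b) = 1 + (?a + ?b) + ?a * ?b" by (simp add: algebra_simps)
    then show ?thesis by (simp only: power_mult_distrib power2_abs mult.left_commute)
  qed
  also have "\<dots> \<le> ?r\<^sup>2 * ((v - u)\<^sup>2 * (3 * (1 + (?a + ?b)\<^sup>2 + (?a * ?b)\<^sup>2)))"
  proof (intro mult_left_mono)
    have "(x + y + z)\<^sup>2 \<le> 3 * (x\<^sup>2 + y\<^sup>2 + z\<^sup>2)" for x y z :: real
      using sum_squares_ge_zero[of "x - y" "y - z"] zero_le_power2[of "x - z"]
      by (simp add: power2_eq_square algebra_simps)
    from this[of 1 "?a + ?b" "?a * ?b"]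
    show "(1 + (?a + ?b) + ?a * ?b)\<^sup>2 \<le> 3 * (1 + (?a + ?b)\<^sup>2 + (?a * ?b)\<^sup>2)" by simp
  qed auto
  also have "\<dots> = 3 * ?r\<^sup>2 * ((v - u)\<^sup>2 + ((v - u) * (?a + ?b))\<^sup>2 + ((v - u) * (?a * ?b))\<^sup>2)"
    unfolding power_mult_distrib[of "v - u"] by (simp add: distrib_left mult.left_commute)
  also have "\<dots> \<le> 3 * (real (E + 2))\<^sup>2 * ((v - u)\<^sup>2 + (v ^ Suc E - u ^ Suc E)\<^sup>2
        + (u ^ E * v ^ Suc E - u ^ Suc E * v ^ E)\<^sup>2)"
  proof -
    have r: "?r\<^sup>2 \<le> (real (E + 2))\<^sup>2" by (intro power_mono) auto
    have "?a + ?b = (\<Sum>i\<in>{0, E}. u ^ (E - i) * v ^ i)"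
      using E by simp
    also have "\<dots> \<le> (\<Sum>i<Suc E. u ^ (E - i) * v ^ i)"
      using u v by (intro sum_mono2) auto
    finally have le: "?a + ?b \<le> (\<Sum>i<Suc E. u ^ (E - i) * v ^ i)" .
    have "\<bar>(v - u) * (?a + ?b)\<bar> \<le> \<bar>v - u\<bar> * (\<Sum>i<Suc E. u ^ (E - i) * v ^ i)"
      using le ab by (simp only: abs_mult) (intro mult_left_mono, auto)
    also have "\<dots> = \<bar>v ^ Suc E - u ^ Suc E\<bar>"
      using power_diff_sumr2[of v "Suc E" u] u v
      by (simp add: abs_mult sum_nonneg del: sum.lessThan_Suc power_Suc)
    finally have main: "((v - u) * (?a + ?b))\<^sup>2 \<le> (v ^ Suc E - u ^ Suc E)\<^sup>2"
      by (simp only: abs_le_square_iff)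
    have third: "((v - u) * (?a * ?b))\<^sup>2 \<le> (u ^ E * v ^ Suc E - u ^ Suc E * v ^ E)\<^sup>2"
      by (simp add: algebra_simps)
    show ?thesis
      using r main third by (intro mult_mono add_mono order.refl) simp_all
  qed
  finally show ?thesis .
qed

text \<open>
  The size of the negative entries is chosen for the \<open>D\<^sup>2\<close> ordered pairs of exponents, each of which
  costs at most \<open>3 D\<^sup>2\<close> times the sum of the corner squares.
\<close>

definition block_coeff :: "nat \<Rightarrow> nat \<Rightarrow> real" where
  "block_coeff D i = (if i \<in> {0, 1, D - 2, D - 1} then 1 else - 1 / (3 * real D ^ 4))"

definition block :: "nat \<Rightarrow> real \<Rightarrow> real" where
  "block D x = (\<Sum>i<D. block_coeff D i * x ^ i)"

lemma block_coeff_bounds: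
  assumes "D \<ge> 1"
  shows "- 1 / (3 * real D ^ 4) \<le> block_coeff D i" "\<bar>block_coeff D i\<bar> \<le> 1"
    "- 1 / (3 * real D ^ 4) \<le> block_coeff D i * block_coeff D j"
proof -
  define e where "e = 1 / (3 * real D ^ 4)"
  have "1 \<le> real D ^ 4" using assms by (simp add: one_le_power)
  then have "1 \<le> 3 * real D ^ 4" by linarith
  then have e: "0 < e" "e \<le> 1"
    unfolding e_def by (simp_all only: divide_le_eq_1 zero_less_divide_1_iff) auto
  have ee: "e * e \<ge> 0" by simp
  have b: "block_coeff D i = (if i \<in> {0, 1, D - 2, D - 1} then 1 else - e)" for i
    by (simp add: block_coeff_def e_def)
  show "- 1 / (3 * real D ^ 4) \<le> block_coeff D i" "\<bar>block_coeff D i\<bar> \<le> 1"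
    "- 1 / (3 * real D ^ 4) \<le> block_coeff D i * block_coeff D j"
    using e ee unfolding b by (auto simp flip: e_def simp: e_def[symmetric, unfolded minus_divide_left])
qed

text \<open>
  Every product of two coefficients is at least \<open>- e\<close> with \<open>e = 1 / (3 D\<^sup>4)\<close>. Raising all products
  by \<open>e\<close> makes the sum of squares at least its corner part \<open>X\<close>, and undoing this costs at most
  \<open>e D\<^sup>2 (3 D\<^sup>2 X) = X\<close>.
\<close>

lemma block_mid_convex:
  assumes D: "D \<ge> 4" and u: "0 \<le> u" and v: "0 \<le> v"
  shows "(block D (u * v))\<^sup>2 \<le> block D (u\<^sup>2) * block D (v\<^sup>2)"
proof -
  define E where "E = D - 2"
  have DE: "D = E + 2" and E: "E \<ge> 2" using D by (auto simp: E_def)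
  let ?b = "block_coeff D"
  define T where "T i j = (u ^ i * v ^ j - u ^ j * v ^ i)\<^sup>2" for i j
  define e where "e = 1 / (3 * real D ^ 4)"
  define X where "X = T 0 1 + T 0 (Suc E) + T E (Suc E)"
  have T0: "T i j \<ge> 0" for i j by (simp add: T_def)
  have X0: "X \<ge> 0" using T0 by (simp add: X_def)
  have e0: "e > 0" using D by (simp add: e_def)
  have T_le: "T i j \<le> 3 * (real D)\<^sup>2 * X" if "i < D" "j < D" for i j
    using swapped_monomials_dominated[OF u v, of i E j] that E
    unfolding T_def X_def DE by (simp add: algebra_simps)
  define P where "P = {(0, 1), (0, Suc E), (E, Suc E)}"
  have b1: "?b i * ?b j = 1" if "(i, j) \<in> P" for i j
    using that by (auto simp: P_def block_coeff_def DE)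
  have "X = (\<Sum>(i,j)\<in>P. T i j)"
    using E by (simp add: P_def X_def)
  also have "\<dots> \<le> (\<Sum>(i,j)\<in>P. (?b i * ?b j + e) * T i j)"
  proof (intro sum_mono, clarify)
    fix i j assume "(i, j) \<in> P"
    then have "?b i * ?b j + e \<ge> 1" using b1 e0 by simp
    from mult_right_mono[OF this T0[of i j]]
    show "T i j \<le> (?b i * ?b j + e) * T i j" by simp
  qed
  also have "\<dots> \<le> (\<Sum>(i,j)\<in>{..<D}\<times>{..<D}. (?b i * ?b j + e) * T i j)"
    using block_coeff_bounds(3)[of D] D T0
    by (intro sum_mono2) (auto simp: P_def DE e_def intro!: mult_nonneg_nonneg, (smt (verit))+)
  also have "\<dots> = (\<Sum>i<D. \<Sum>j<D. ?b i * ?b j * T i j) + (\<Sum>i<D. \<Sum>j<D. e * T i j)"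
    by (simp add: sum.cartesian_product[symmetric] sum.distrib[symmetric] algebra_simps)
  also have "(\<Sum>i<D. \<Sum>j<D. e * T i j) \<le> (\<Sum>i<D. \<Sum>j<D. e * (3 * (real D)\<^sup>2 * X))"
    using e0 T_le by (intro sum_mono mult_left_mono) auto
  also have "\<dots> = X"
    using D by (simp add: e_def field_simps power2_eq_square power4_eq_xxxx)
  finally have "0 \<le> (\<Sum>i<D. \<Sum>j<D. ?b i * ?b j * T i j)" by simp
  then show ?thesis
    using mid_convexity_defect[where D = D and b = ?b and u = u and v = v]
    unfolding block_def T_def by simp
qed

text \<open>
  The same compensation, one dimension lower: the increments of \<open>x\<close> and of \<open>x\<^sup>D\<^sup>-\<^sup>1\<close> dominate those of
  all powers in between.
\<close>

lemma block_mono: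
  assumes D: "D \<ge> 4" and x: "0 \<le> x" and xy: "x \<le> y"
  shows "block D x \<le> block D y"
proof -
  define E where "E = D - 2"
  have DE: "D = E + 2" and E: "E \<ge> 2" using D by (auto simp: E_def)
  have y: "y \<ge> 0" using x xy by simp
  define e where "e = 1 / (3 * real D ^ 4)"
  have e0: "e > 0" using D by (simp add: e_def)
  define d where "d i = y ^ i - x ^ i" for i
  have d0: "d i \<ge> 0" for i using x xy by (simp add: d_def power_mono)
  define X where "X = d 1 + d (Suc E)"
  have X0: "X \<ge> 0" using d0 by (simp add: X_def)
  have d_le: "d i \<le> real D * X" if i: "i < D" for i
  proof -
    have "d i = (y - x) * (\<Sum>j<i. x ^ (i - Suc j) * y ^ j)"
      by (simp add: d_def power_diff_sumr2)
    also have "\<dots> \<le> (y - x) * (\<Sum>j<i. 1 + y ^ E)"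
    proof (intro mult_left_mono sum_mono)
      fix j assume "j \<in> {..<i}"
      then have "x ^ (i - Suc j) * y ^ j \<le> y ^ (i - Suc j) * y ^ j"
        using x xy by (intro mult_right_mono power_mono) auto
      also have "\<dots> = y ^ (i - 1)"
        using \<open>j \<in> {..<i}\<close> by (simp flip: power_add)
      also have "\<dots> \<le> 1 + y ^ E"
        using y i by (intro power_le_one_plus_power) (auto simp: DE)
      finally show "x ^ (i - Suc j) * y ^ j \<le> 1 + y ^ E" .
    qed (use xy in auto)
    also have "\<dots> \<le> (y - x) * (real D * (1 + y ^ E))"
      using i xy y by (intro mult_left_mono) (auto intro!: mult_right_mono)
    also have "\<dots> = real D * (d 1 + (y - x) * y ^ E)"
      by (simp add: d_def algebra_simps)
    also have "\<dots> \<le> real D * X"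
    proof (rule mult_left_mono)
      have "x * x ^ E \<le> x * y ^ E"
        using x xy by (intro mult_left_mono power_mono)
      then show "d 1 + (y - x) * y ^ E \<le> X"
        by (simp add: X_def d_def algebra_simps)
    qed simp
    finally show ?thesis .
  qed
  have "X = (\<Sum>i\<in>{1, Suc E}. d i)" using E by (simp add: X_def)
  also have "\<dots> \<le> (\<Sum>i\<in>{1, Suc E}. (block_coeff D i + e) * d i)"
    using e0 d0 by (intro sum_mono) (auto simp: block_coeff_def DE algebra_simps)
  also have "\<dots> \<le> (\<Sum>i<D. (block_coeff D i + e) * d i)"
    using block_coeff_bounds(1)[of D] D d0
    by (intro sum_mono2) (auto simp: DE e_def intro!: mult_nonneg_nonneg, (smt (verit))+)
  also have "\<dots> = (\<Sum>i<D. block_coeff D i * d i) + (\<Sum>i<D. e * d i)"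
    by (simp add: sum.distrib algebra_simps)
  also have "(\<Sum>i<D. e * d i) \<le> (\<Sum>i<D. e * (real D * X))"
    using e0 d_le by (intro sum_mono mult_left_mono) auto
  also have "\<dots> = (e * (real D)\<^sup>2) * X"
    by (simp add: power2_eq_square)
  also have "\<dots> \<le> 1 * X"
  proof (intro mult_right_mono X0)
    have "(real D)\<^sup>2 \<le> real D ^ 4" using D by (intro power_increasing) auto
    then have "(real D)\<^sup>2 \<le> 3 * real D ^ 4"
      using zero_le_power2[of "real D"] by linarith
    then show "e * (real D)\<^sup>2 \<le> 1" using D by (simp add: e_def)
  qed
  finally have "0 \<le> (\<Sum>i<D. block_coeff D i * d i)" by simp
  then show ?thesis
    by (simp add: block_def d_def algebra_simps sum_subtractf)
qed

lemma block_mult_convex_superadditive: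
  assumes "D \<ge> 4" "N \<ge> 1" "c \<ge> 0"
  shows "mult_convex_superadditive (\<lambda>x. c * (x ^ N * block D x))"
proof (rule mult_convex_superadditive_monomial_mult)
  have "block D 0 = (\<Sum>i\<in>{0}. block_coeff D i * 0 ^ i)"
    unfolding block_def using assms by (intro sum.mono_neutral_right) auto
  then show "block D 0 \<ge> 0" by (simp add: block_coeff_def)
qed (use assms block_mono block_mid_convex in auto)

section \<open>The entire series\<close>

text \<open>
  An exponent \<open>n \<ge> 4\<close> lies in the block of length \<open>D\<close> that starts at the largest power \<open>D\<close> of two
  with \<open>D \<le> n\<close>. The weight has to be the same throughout the block, and \<open>1 / fact (2 D)\<close> is
  below \<open>1 / fact n\<close> there. The exponents below \<open>4\<close> are left out because a block needs \<open>D \<ge> 4\<close>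
  for its four outer positions to be distinct.
\<close>

definition gap_coeff :: "nat \<Rightarrow> real" where
  "gap_coeff n = (if n < 4 then 0 else
     let D = 2 ^ floor_log n in block_coeff D (n - D) / fact (2 * D))"

lemma gap_coeff_in_block:
  assumes "k \<ge> 2" "i < 2 ^ k"
  shows "gap_coeff (2 ^ k + i) = block_coeff (2 ^ k) i / fact (2 * 2 ^ k)"
proof -
  have "(2::nat) ^ 2 \<le> 2 ^ k" using assms by (intro power_increasing) auto
  then have "\<not> 2 ^ k + i < (4::nat)" by simp
  moreover have "floor_log (2 ^ k + i) = k"
    using assms by (intro floor_log_eqI) auto
  ultimately show ?thesis by (simp only: gap_coeff_def Let_def) simp
qed

lemma abs_gap_coeff_le: "\<bar>gap_coeff n\<bar> \<le> 1 / fact n"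
proof (cases "n < 4")
  case True
  then show ?thesis by (simp add: gap_coeff_def)
next
  case False
  define D :: nat where "D = 2 ^ floor_log n"
  have D: "D \<ge> 1" "n \<le> 2 * D"
    using floor_log_exp2_ge[of n] by (simp_all add: D_def)
  have "\<bar>gap_coeff n\<bar> = \<bar>block_coeff D (n - D)\<bar> / fact (2 * D)"
    using False by (simp add: gap_coeff_def Let_def flip: D_def)
  also have "\<dots> \<le> 1 / fact (2 * D)"
    using block_coeff_bounds(2)[OF D(1)] by (intro divide_right_mono) simp_all
  also have "\<dots> \<le> 1 / fact n"
    using D(2) by (intro divide_left_mono fact_mono mult_pos_pos) simp_all
  finally show ?thesis .
qed

lemma gap_coeff_negative_strings: "\<exists>m. \<forall>k<L. gap_coeff (m + k) < 0"
proof -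
  define K where "K = L + 4"
  define D :: nat where "D = 2 ^ K"
  have D: "L + 4 < D" using less_exp[of K] by (simp add: D_def K_def)
  have "gap_coeff (D + 2 + k) < 0" if "k < L" for k
  proof -
    have "gap_coeff (D + (2 + k)) = block_coeff D (2 + k) / fact (2 * D)"
      unfolding D_def by (rule gap_coeff_in_block) (use that D in \<open>simp_all add: D_def[symmetric]\<close>, simp add: K_def)
    moreover have "2 + k \<noteq> D - 2" "2 + k \<noteq> D - 1" "D > 0"
      using that D by linarith+
    then have "block_coeff D (2 + k) < 0"
      by (simp add: block_coeff_def)
    ultimately show ?thesis
      by (simp add: divide_neg_pos add.assoc)
  qed
  then show ?thesis by blast
qed

lemma summable_gap_coeff:
  fixes z :: "'a :: {real_normed_field, banach}"
  shows "summable (\<lambda>n. of_real (gap_coeff n) * z ^ n)"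
proof (rule summable_comparison_test')
  show "summable (\<lambda>n. norm z ^ n /\<^sub>R fact n)"
    by (rule summable_exp_generic)
  show "norm (of_real (gap_coeff n) * z ^ n) \<le> norm z ^ n /\<^sub>R fact n" if "n \<ge> 0" for n
    using mult_right_mono[OF abs_gap_coeff_le[of n], of "norm z ^ n"]
    by (simp add: norm_mult norm_power divide_inverse)
qed

lemma sum_lessThan_add:
  fixes g :: "nat \<Rightarrow> 'a :: comm_monoid_add"
  shows "sum g {..<m + n} = sum g {..<m} + (\<Sum>i<n. g (m + i))"
  by (induction n) (simp_all add: add.assoc)

text \<open>
  Cutting the series at powers of two never splits a block. A general partial sum may end on
  negative terms and need not even be nonnegative.
\<close>

lemma gap_partial_sum_mult_convex_superadditive:
  "mult_convex_superadditive (\<lambda>x. \<Sum>n<2 ^ (k + 2). gap_coeff n * x ^ n)"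
proof (induction k)
  case 0
  have "(\<lambda>x. \<Sum>n<2 ^ (0 + 2). gap_coeff n * x ^ n) = (\<lambda>x. 0)"
    by (intro ext sum.neutral) (simp add: gap_coeff_def)
  then show ?case by (simp add: mult_convex_superadditive_def)
next
  case (Suc k)
  define D :: nat where "D = 2 ^ (k + 2)"
  have "(2::nat) ^ 2 \<le> D" unfolding D_def by (intro power_increasing) auto
  then have D: "D \<ge> 4" by simp
  have "(\<Sum>n<2 ^ (Suc k + 2). gap_coeff n * x ^ n)
      = (\<Sum>n<D. gap_coeff n * x ^ n) + 1 / fact (2 * D) * (x ^ D * block D x)" for x
  proof -
    have "(\<Sum>i<D. gap_coeff (D + i) * x ^ (D + i))
        = (\<Sum>i<D. 1 / fact (2 * D) * (x ^ D * (block_coeff D i * x ^ i)))"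
    proof (intro sum.cong refl)
      fix i assume "i \<in> {..<D}"
      then have "gap_coeff (D + i) = block_coeff D i / fact (2 * D)"
        unfolding D_def by (intro gap_coeff_in_block) auto
      then show "gap_coeff (D + i) * x ^ (D + i) = 1 / fact (2 * D) * (x ^ D * (block_coeff D i * x ^ i))"
        by (simp add: power_add)
    qed
    also have "\<dots> = 1 / fact (2 * D) * (x ^ D * block D x)"
      by (simp only: block_def sum_distrib_left)
    moreover have "2 ^ (Suc k + 2) = D + D" by (simp add: D_def)
    ultimately show ?thesis by (simp only: sum_lessThan_add)
  qed
  moreover have "mult_convex_superadditive (\<lambda>x. 1 / fact (2 * D) * (x ^ D * block D x))"
    using D by (intro block_mult_convex_superadditive) simp_all
  ultimately show ?case
    using mult_convex_superadditive_add[OF Suc.IH] by (simp only: D_def)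
qed

lemma gap_series_mult_convex_superadditive:
  "mult_convex_superadditive (\<lambda>x. \<Sum>n. gap_coeff n * x ^ n)"
proof (rule mult_convex_superadditive_limit[OF gap_partial_sum_mult_convex_superadditive])
  fix x :: real
  have "strict_mono (\<lambda>k::nat. 2 ^ (k + 2) :: nat)"
    by (intro strict_monoI power_strict_increasing) auto
  moreover have "(\<lambda>N. \<Sum>n<N. gap_coeff n * x ^ n) \<longlonglongrightarrow> (\<Sum>n. gap_coeff n * x ^ n)"
    using summable_LIMSEQ[OF summable_gap_coeff[of x]] by simp
  ultimately show "(\<lambda>k. \<Sum>n<2 ^ (k + 2). gap_coeff n * x ^ n) \<longlonglongrightarrow> (\<Sum>n. gap_coeff n * x ^ n)"
    using LIMSEQ_subseq_LIMSEQ[unfolded o_def] by fastforce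
qed

section \<open>Derivatives of power series at the origin\<close>

lemma funpow_diffs:
  fixes c :: "nat \<Rightarrow> 'a :: {semiring_char_0, comm_ring_1}"
  shows "fact n * (diffs ^^ k) c n = fact (n + k) * c (n + k)"
proof (induction k arbitrary: n)
  case (Suc k)
  have "fact n * (diffs ^^ Suc k) c n = fact (Suc n) * (diffs ^^ k) c (Suc n)"
    by (simp add: diffs_def algebra_simps)
  also have "\<dots> = fact (Suc n + k) * c (Suc n + k)" by (rule Suc.IH)
  finally show ?case by simp
qed simp

lemma entire_series_funpow_deriv:
  fixes c :: "nat \<Rightarrow> 'a :: {real_normed_field, banach}"
  assumes "\<And>x. summable (\<lambda>n. c n * x ^ n)"
  shows "(deriv ^^ k) (\<lambda>x. \<Sum>n. c n * x ^ n) = (\<lambda>x. \<Sum>n. (diffs ^^ k) c n * x ^ n)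
    \<and> (\<forall>x. summable (\<lambda>n. (diffs ^^ k) c n * x ^ n))"
proof (induction k)
  case 0
  then show ?case using assms by simp
next
  case (Suc k)
  then have eq: "(deriv ^^ k) (\<lambda>x. \<Sum>n. c n * x ^ n) = (\<lambda>x. \<Sum>n. (diffs ^^ k) c n * x ^ n)"
    and sm: "\<And>x. summable (\<lambda>n. (diffs ^^ k) c n * x ^ n)" by auto
  have "deriv (\<lambda>x. \<Sum>n. (diffs ^^ k) c n * x ^ n) = (\<lambda>x. \<Sum>n. diffs ((diffs ^^ k) c) n * x ^ n)"
    by (intro ext DERIV_imp_deriv termdiffs_strong_converges_everywhere sm)
  then show ?case using eq termdiff_converges_all[OF sm] by simp
qed

text \<open>
  The \<open>k\<close>-th derivative equals \<open>fact k * c k < 0\<close> at the origin and is continuous there. The point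
  has to be found to the right of \<open>0\<close>, since absolute monotonicity on \<open>[0, \<infinity>)\<close> only speaks about
  derivatives in the interior.
\<close>

lemma negative_coeff_not_absolutely_monotonic:
  fixes c :: "nat \<Rightarrow> real"
  assumes sm: "\<And>x. summable (\<lambda>n. c n * x ^ n)" and neg: "c k < 0"
  shows "\<exists>x>0. (deriv ^^ k) (\<lambda>x. \<Sum>n. c n * x ^ n) x < 0"
proof (rule ccontr)
  assume none: "\<not> (\<exists>x>0. (deriv ^^ k) (\<lambda>x. \<Sum>n. c n * x ^ n) x < 0)"
  define h where "h = (deriv ^^ k) (\<lambda>x. \<Sum>n. c n * x ^ n)"
  have nonneg: "h x \<ge> 0" if "x > 0" for x
    using none that unfolding h_def by (meson not_less)
  have h: "h = (\<lambda>x. \<Sum>n. (diffs ^^ k) c n * x ^ n)"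
    and smk: "\<And>x. summable (\<lambda>n. (diffs ^^ k) c n * x ^ n)"
    using entire_series_funpow_deriv[OF sm, of k] by (auto simp: h_def)
  have "isCont h 0"
    unfolding h by (rule DERIV_isCont[OF termdiffs_strong_converges_everywhere[OF smk]])
  then have "(h \<longlongrightarrow> h 0) (at_right 0)"
    by (simp add: isCont_def filterlim_at_split)
  then have "h 0 \<ge> 0"
    by (rule tendsto_lowerbound) (auto simp: eventually_at_right_less nonneg intro: eventually_mono[OF eventually_at_right_less[of 0]])
  moreover have "h 0 = fact k * c k"
    using funpow_diffs[of 0 k c] by (simp add: h powser_zero)
  ultimately show False
    using mult_pos_neg[OF fact_gt_zero neg, of k] by simp
qed

section \<open>Positive semidefinite matrices on forests\<close>

text \<open>
  Matrices are represented by functions on a finite index set: deleting a leaf then amounts to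
  shrinking the set, without renumbering rows and columns.
\<close>

definition quad_form :: "'i set \<Rightarrow> ('i \<Rightarrow> 'i \<Rightarrow> real) \<Rightarrow> ('i \<Rightarrow> real) \<Rightarrow> real" where
  "quad_form V a x = (\<Sum>i\<in>V. \<Sum>j\<in>V. x i * a i j * x j)"

text \<open>
  A graph is a forest exactly if each of its nonempty induced subgraphs has a vertex of degree at
  most one. This form passes to subsets at once, and \<open>p\<close>, the only possible neighbour of \<open>w\<close>, is an
  arbitrary element, possibly outside \<open>W\<close>, when \<open>w\<close> is isolated.
\<close>

definition forest_pattern :: "'i set \<Rightarrow> ('i \<Rightarrow> 'i \<Rightarrow> real) \<Rightarrow> bool" where
  "forest_pattern V a \<longleftrightarrow>
     (\<forall>W\<subseteq>V. W \<noteq> {} \<longrightarrow> (\<exists>w\<in>W. \<exists>p. \<forall>u\<in>W. u \<noteq> w \<and> u \<noteq> p \<longrightarrow> a w u = 0))"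

lemma quad_form_cong:
  assumes "\<And>i j. i \<in> V \<Longrightarrow> j \<in> V \<Longrightarrow> a i j = b i j" "\<And>i. i \<in> V \<Longrightarrow> x i = y i"
  shows "quad_form V a x = quad_form V b y"
  unfolding quad_form_def using assms by (intro sum.cong refl) auto

lemma quad_form_insert:
  assumes "finite V" "w \<notin> V" and sym: "\<And>j. j \<in> V \<Longrightarrow> a j w = a w j"
  shows "quad_form (insert w V) a x
    = a w w * (x w)\<^sup>2 + 2 * x w * (\<Sum>j\<in>V. a w j * x j) + quad_form V a x"
proof -
  have "(\<Sum>i\<in>V. x i * a i w * x w) = x w * (\<Sum>j\<in>V. a w j * x j)"
    unfolding sum_distrib_left by (intro sum.cong refl) (simp add: sym)
  moreover have "(\<Sum>j\<in>V. x w * a w j * x j) = x w * (\<Sum>j\<in>V. a w j * x j)"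
    unfolding sum_distrib_left by (simp add: mult.assoc)
  ultimately show ?thesis
    using assms(1,2) by (simp add: quad_form_def sum.distrib power2_eq_square algebra_simps)
qed

lemma quad_form_diagonal_shift:
  assumes "finite V" "p \<in> V"
  shows "quad_form V (\<lambda>i j. if i = p \<and> j = p then c else a i j) x
    = quad_form V a x + (c - a p p) * (x p)\<^sup>2"
proof -
  have "quad_form V (\<lambda>i j. if i = p \<and> j = p then c else a i j) x
    = (\<Sum>i\<in>V. \<Sum>j\<in>V. x i * a i j * x j + (if i = p then if j = p then (c - a p p) * (x p)\<^sup>2 else 0 else 0))"
    unfolding quad_form_def
    by (intro sum.cong refl) (auto simp: power2_eq_square algebra_simps)
  also have "\<dots> = quad_form V a x + (\<Sum>i\<in>V. if i = p then (c - a p p) * (x p)\<^sup>2 else 0)"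
    unfolding sum.distrib quad_form_def using assms
    by (intro arg_cong2[where f = "(+)"] sum.cong refl) auto
  finally show ?thesis using assms by simp
qed

lemma quad_form_leaf:
  assumes "finite V" "w \<notin> V" "p \<in> V"
    and sym: "\<And>j. j \<in> V \<Longrightarrow> a j w = a w j"
    and leaf: "\<And>j. j \<in> V \<Longrightarrow> j \<noteq> p \<Longrightarrow> a w j = 0"
  shows "quad_form (insert w V) a x
    = a w w * (x w)\<^sup>2 + 2 * x w * (a w p * x p) + quad_form V a x"
proof -
  have "(\<Sum>j\<in>V. a w j * x j) = (\<Sum>j\<in>{p}. a w j * x j)"
    using assms by (intro sum.mono_neutral_right) auto
  then show ?thesis
    using quad_form_insert[of V w a x] assms(1,2) sym by simp
qed

lemma binary_quadratic_nonneg: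
  fixes A B C :: real
  assumes "A \<ge> 0" "C \<ge> 0" "B\<^sup>2 \<le> A * C"
  shows "A * x\<^sup>2 + 2 * x * (B * y) + C * y\<^sup>2 \<ge> 0"
proof (cases "A = 0")
  case True
  then show ?thesis using assms by simp
next
  case False
  then have A: "A > 0" using assms by simp
  have "A * (A * x\<^sup>2 + 2 * x * (B * y) + C * y\<^sup>2) = (A * x + B * y)\<^sup>2 + (A * C - B\<^sup>2) * y\<^sup>2"
    by (simp add: power2_eq_square algebra_simps)
  also have "\<dots> \<ge> 0" using assms by simp
  finally show ?thesis using A by (simp add: zero_le_mult_iff)
qed

text \<open>
  Were \<open>A \<le> 0\<close>, the quadratic polynomial would be at most the linear one \<open>2 s B + C\<close>, which is
  negative at \<open>s = - (C + 1) / (2 B)\<close>. For \<open>A > 0\<close>, its minimum \<open>C - B\<^sup>2 / A\<close> is attained at \<open>s = - B / A\<close>.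
\<close>

lemma leaf_diagonal_pos:
  fixes A B C :: real
  assumes nonneg: "\<And>s. A * s\<^sup>2 + 2 * s * B + C \<ge> 0" and B: "B \<noteq> 0"
  shows "A > 0" "B\<^sup>2 / A \<le> C"
proof -
  show A: "A > 0"
  proof (rule ccontr)
    assume "\<not> A > 0"
    define s where "s = - (C + 1) / (2 * B)"
    have "A * s\<^sup>2 \<le> 0" using \<open>\<not> A > 0\<close> by (simp add: mult_le_0_iff)
    moreover have "2 * s * B = - (C + 1)" using B by (simp add: s_def)
    ultimately show False using nonneg[of s] by simp
  qed
  show "B\<^sup>2 / A \<le> C"
    using nonneg[of "- B / A"] A by (simp add: power2_eq_square field_simps)
qed

text \<open>
  Induction on the number of vertices. Removing a leaf \<open>w\<close> with neighbour \<open>p\<close> replaces \<open>a\<close> by its Schur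
  complement \<open>b\<close>, which differs from \<open>a\<close> only at \<open>(p, p)\<close>. So it has the same pattern, and its
  entries remain nonnegative because \<open>t \<le> a p p\<close>. What \<open>f\<close> gains at \<open>(p, p)\<close> when \<open>t\<close> is added back
  is at least \<open>f t\<close>, which is just enough for the binary form in \<open>x w\<close> and \<open>x p\<close>.
\<close>

lemma forest_entrywise_psd:
  fixes a :: "'i \<Rightarrow> 'i \<Rightarrow> real"
  assumes f: "mult_convex_superadditive f"
    and "finite V"
    and "\<And>i j. i \<in> V \<Longrightarrow> j \<in> V \<Longrightarrow> 0 \<le> a i j"
    and "\<And>i j. i \<in> V \<Longrightarrow> j \<in> V \<Longrightarrow> a i j = a j i"
    and "forest_pattern V a"
    and "\<And>x. 0 \<le> quad_form V a x"
  shows "0 \<le> quad_form V (\<lambda>i j. f (a i j)) x"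
  using assms(2-)
proof (induction "card V" arbitrary: V a x)
  case 0
  then show ?case by (simp add: quad_form_def)
next
  case (Suc n)
  note pos = Suc.prems(2) and sym = Suc.prems(3) and forest = Suc.prems(4) and psd = Suc.prems(5)
  note f_nonneg = mult_convex_superadditiveD(1)[OF f]
    and f_conv = mult_convex_superadditiveD(2)[OF f]
    and f_super = mult_convex_superadditiveD(3)[OF f]
    and f0 = mult_convex_superadditiveD(4)[OF f]
  have "V \<noteq> {}" using Suc.hyps(2) by auto
  then obtain w p where w: "w \<in> V" and leaf: "\<And>u. u \<in> V \<Longrightarrow> u \<noteq> w \<Longrightarrow> u \<noteq> p \<Longrightarrow> a w u = 0"
    using forest[unfolded forest_pattern_def, rule_format, of V] by auto
  define U where "U = V - {w}"
  have V: "V = insert w U" and wU: "w \<notin> U" and U: "U \<subseteq> V" and finU: "finite U" and cU: "n = card U"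
    using w Suc.hyps(2) Suc.prems(1) by (auto simp: U_def)
  have forestU: "forest_pattern U a"
    using forest U unfolding forest_pattern_def by (meson order_trans)
  have symU: "a j w = a w j" if "j \<in> U" for j using sym that w U by auto
  have symUU: "a i j = a j i" and posU: "0 \<le> a i j" if "i \<in> U" "j \<in> U" for i j
  proof -
    have "i \<in> V" "j \<in> V" using that U by auto
    then show "a i j = a j i" "0 \<le> a i j" by (rule sym, rule pos)
  qed
  have aww: "a w w \<ge> 0" using pos w by simp
  show ?case
  proof (cases "p \<in> U \<and> a w p \<noteq> 0")
    case False
    then have zero: "a w j = 0" if "j \<in> U" for j
      using leaf[of j] that wU U by (metis subsetD)
    have psdU: "0 \<le> quad_form U a y" for y
    proof -
      have "quad_form U a y = quad_form U a (y(w := 0))"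
        using wU by (intro quad_form_cong) auto
      also have "\<dots> = quad_form V a (y(w := 0))"
        unfolding V using quad_form_insert[of U w a "y(w := 0)"] finU wU symU by simp
      finally show ?thesis using psd by simp
    qed
    have "quad_form V (\<lambda>i j. f (a i j)) x = f (a w w) * (x w)\<^sup>2 + quad_form U (\<lambda>i j. f (a i j)) x"
      unfolding V using quad_form_insert[of U w "\<lambda>i j. f (a i j)" x] finU wU symU zero f0 by simp
    moreover have "0 \<le> quad_form U (\<lambda>i j. f (a i j)) x"
      by (rule Suc.hyps(1)[OF cU finU posU symUU forestU psdU])
    ultimately show ?thesis using f_nonneg[OF aww] by simp
  next
    case True
    then have p: "p \<in> U" and awp: "a w p \<noteq> 0" by auto
    have leafU: "a w j = 0" if "j \<in> U" "j \<noteq> p" for j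
      using leaf[of j] that wU U by auto
    have app: "a p p \<ge> 0" and awp0: "a w p \<ge> 0" using pos w p U by auto
    have expand: "quad_form V a y = a w w * (y w)\<^sup>2 + 2 * y w * (a w p * y p) + quad_form U a y" for y
      unfolding V by (rule quad_form_leaf) (use finU wU p symU leafU in auto)
    \<comment> \<open>Vectors supported on the edge from \<open>w\<close> to \<open>p\<close> give the \<open>2 \<times> 2\<close> principal minor.\<close>
    have unit: "quad_form U a (\<lambda>i. if i = p then 1 else if i = w then s else 0) = a p p" for s
    proof -
      have "quad_form U a (\<lambda>i. if i = p then 1 else if i = w then s else 0)
         = (\<Sum>i\<in>{p}. \<Sum>j\<in>{p}. a i j)"
        unfolding quad_form_def using finU p wU
        by (intro sum.mono_neutral_cong_right) (auto intro!: sum.neutral sum.mono_neutral_cong_right)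
      then show ?thesis by simp
    qed
    have "a w w * s\<^sup>2 + 2 * s * a w p + a p p \<ge> 0" for s
    proof -
      let ?y = "\<lambda>i. if i = p then 1 else if i = w then s else 0"
      have "?y w = s" "?y p = 1" using p wU by auto
      then show ?thesis using psd[of ?y] expand[of ?y] unit[of s] by simp
    qed
    from leaf_diagonal_pos[OF this awp] have aww_pos: "a w w > 0" and t_le: "(a w p)\<^sup>2 / a w w \<le> a p p"
      by auto
    define t where "t = (a w p)\<^sup>2 / a w w"
    have t0: "t \<ge> 0" using aww_pos by (simp add: t_def)
    define b where "b i j = (if i = p \<and> j = p then a p p - t else a i j)" for i j
    have b_shift: "quad_form U b y = quad_form U a y - t * (y p)\<^sup>2" for y
      unfolding b_def using quad_form_diagonal_shift[OF finU p, of "a p p - t" a y] by simp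
    have psdb: "0 \<le> quad_form U b y" for y
    proof -
      \<comment> \<open>The value at \<open>w\<close> minimises the form of \<open>a\<close> over all extensions of \<open>y\<close>; the minimum is the
        Schur complement.\<close>
      define z where "z = y(w := - a w p * y p / a w w)"
      have z: "z w = - a w p * y p / a w w" "z p = y p"
        using p wU by (auto simp: z_def)
      have U_eq: "quad_form U a z = quad_form U a y"
        using wU by (intro quad_form_cong) (auto simp: z_def)
      have schur: "A * (- B * s / A)\<^sup>2 + 2 * (- B * s / A) * (B * s) = - (B\<^sup>2 / A * s\<^sup>2)"
        if "A > 0" for A B s :: real
        using that by (simp add: power2_eq_square field_simps)
      have "quad_form V a z = a w w * (z w)\<^sup>2 + 2 * z w * (a w p * z p) + quad_form U a z"
        by (rule expand)
      also have "\<dots> = quad_form U b y"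
        unfolding z U_eq b_shift t_def using schur[OF aww_pos, of "a w p" "y p"] by linarith
      finally show ?thesis using psd[of z] by linarith
    qed
    have forestb: "forest_pattern U b"
      unfolding forest_pattern_def
    proof (intro allI impI)
      fix W assume "W \<subseteq> U" "W \<noteq> {}"
      then obtain c q where "c \<in> W" "\<forall>u\<in>W. u \<noteq> c \<and> u \<noteq> q \<longrightarrow> a c u = 0"
        using forestU[unfolded forest_pattern_def, rule_format, of W] by auto
      then show "\<exists>w\<in>W. \<exists>q. \<forall>u\<in>W. u \<noteq> w \<and> u \<noteq> q \<longrightarrow> b w u = 0"
        by (intro bexI[of _ c] exI[of _ q]) (auto simp: b_def)
    qed
    have symb: "b i j = b j i" if "i \<in> U" "j \<in> U" for i j
      using symUU[OF that] by (auto simp: b_def)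
    have posb: "0 \<le> b i j" if "i \<in> U" "j \<in> U" for i j
      using posU[OF that] t_le by (auto simp: b_def t_def)
    have IH: "0 \<le> quad_form U (\<lambda>i j. f (b i j)) x"
      by (rule Suc.hyps(1)[OF cU finU posb symb forestb psdb])
    have "quad_form U (\<lambda>i j. f (b i j)) x
       = quad_form U (\<lambda>i j. if i = p \<and> j = p then f (a p p - t) else f (a i j)) x"
      by (rule quad_form_cong) (auto simp: b_def)
    also have "\<dots> = quad_form U (\<lambda>i j. f (a i j)) x + (f (a p p - t) - f (a p p)) * (x p)\<^sup>2"
      by (rule quad_form_diagonal_shift[OF finU p])
    finally have "quad_form U (\<lambda>i j. f (a i j)) x \<ge> (f (a p p) - f (a p p - t)) * (x p)\<^sup>2"
      using IH by (simp add: algebra_simps)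
    moreover have "f t * (x p)\<^sup>2 \<le> (f (a p p) - f (a p p - t)) * (x p)\<^sup>2"
      using f_super[of t "a p p - t"] t0 t_le by (intro mult_right_mono) (auto simp: t_def)
    moreover have "f (a w w) * (x w)\<^sup>2 + 2 * x w * (f (a w p) * x p) + f t * (x p)\<^sup>2 \<ge> 0"
    proof (rule binary_quadratic_nonneg)
      have "sqrt (a w w) * sqrt t = a w p"
        using aww_pos awp0 by (simp add: t_def real_sqrt_divide)
      then show "(f (a w p))\<^sup>2 \<le> f (a w w) * f t"
        using f_conv[of "sqrt (a w w)" "sqrt t"] aww t0 by simp
    qed (use f_nonneg aww t0 in auto)
    moreover have "quad_form V (\<lambda>i j. f (a i j)) x
        = f (a w w) * (x w)\<^sup>2 + 2 * x w * (f (a w p) * x p) + quad_form U (\<lambda>i j. f (a i j)) x"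
      unfolding V by (rule quad_form_leaf) (use finU wU p symU leafU f0 in auto)
    ultimately show ?thesis by linarith
  qed
qed

section \<open>Trees and stars\<close>

text \<open>
  The counterpart of \<open>forest_pattern\<close> for an edge relation: acyclicity in the form that the
  induction over vertex sets consumes.
\<close>

definition locally_leafy :: "nat pair_pre_digraph \<Rightarrow> bool" where
  "locally_leafy G \<longleftrightarrow>
     (\<forall>W\<subseteq>pverts G. W \<noteq> {} \<longrightarrow> (\<exists>w\<in>W. \<exists>p. \<forall>u\<in>W. (w, u) \<in> parcs G \<longrightarrow> u = p))"

lemma psd_mats_iff_quad_form:
  "A \<in> psd_mats n I \<longleftrightarrow> A \<in> sym_mats n I \<and> (\<forall>x. 0 \<le> quad_form {0..<n} (\<lambda>i j. A $$ (i, j)) x)"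
proof (cases "A \<in> sym_mats n I")
  case True
  then have A: "A \<in> carrier_mat n n" by (simp add: sym_mats_def)
  have form: "scalar_prod x (A *\<^sub>v x) = quad_form {0..<n} (\<lambda>i j. A $$ (i, j)) (\<lambda>i. vec_index x i)"
    if "x \<in> carrier_vec n" for x
    using that A
    by (auto simp: scalar_prod_def quad_form_def sum_distrib_left mult.assoc intro!: sum.cong)
  have psd_iff: "A \<in> psd_mats n I \<longleftrightarrow> (\<forall>x\<in>carrier_vec n. 0 \<le> scalar_prod x (A *\<^sub>v x))"
    using True by (simp add: psd_mats_def)
  show ?thesis
  proof (intro iffI conjI allI)
    fix x assume "A \<in> psd_mats n I"
    then have "0 \<le> scalar_prod (Matrix.vec n x) (A *\<^sub>v Matrix.vec n x)"
      using psd_iff by auto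
    also have "\<dots> = quad_form {0..<n} (\<lambda>i j. A $$ (i, j)) x"
      unfolding form[OF vec_carrier] by (rule quad_form_cong) auto
    finally show "0 \<le> quad_form {0..<n} (\<lambda>i j. A $$ (i, j)) x" .
  next
    assume "A \<in> sym_mats n I \<and> (\<forall>x. 0 \<le> quad_form {0..<n} (\<lambda>i j. A $$ (i, j)) x)"
    then show "A \<in> psd_mats n I"
      unfolding psd_iff by (simp add: form)
  qed (rule True)
qed (simp add: psd_mats_def)

text \<open>
  As \<open>f 0 = 0\<close>, transforming only the entries of the pattern is the same as transforming all of them.
\<close>

lemma graph_entrywise_psd:
  assumes f: "mult_convex_superadditive f" and G: "labelled_graph G" and "locally_leafy G"
    and A: "A \<in> graph_psd_mats G {0..}"
  shows "graph_entrywise G f A \<in> graph_psd_mats G UNIV"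
proof -
  let ?n = "graph_size G" and ?B = "graph_entrywise G f A"
  note f0 = mult_convex_superadditiveD(4)[OF f]
  obtain n where n: "pverts G = {0..<n}"
    using G unfolding labelled_graph_def by blast
  then have pv: "pverts G = {0..<?n}"
    by (simp add: graph_size_def)
  have A_carrier: "A \<in> carrier_mat ?n ?n" and A_tr: "transpose_mat A = A"
    and A_nonneg: "\<And>i j. i < ?n \<Longrightarrow> j < ?n \<Longrightarrow> 0 \<le> A $$ (i, j)"
    and A_zero: "\<And>i j. i < ?n \<Longrightarrow> j < ?n \<Longrightarrow> (i, j) \<notin> parcs G \<Longrightarrow> i \<noteq> j \<Longrightarrow> A $$ (i, j) = 0"
    and A_psd: "\<And>x. 0 \<le> quad_form {0..<?n} (\<lambda>i j. A $$ (i, j)) x"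
    using A by (auto simp: graph_psd_mats_def graph_sym_mats_def sym_mats_def psd_mats_iff_quad_form)
  have A_sym: "A $$ (i, j) = A $$ (j, i)" if "i < ?n" "j < ?n" for i j
    using that A_carrier by (subst A_tr[symmetric]) simp
  have B: "?B $$ (i, j) = f (A $$ (i, j))" if "i < ?n" "j < ?n" for i j
    using that A_zero f0 by (auto simp: graph_entrywise_def)
  have "forest_pattern {0..<?n} (\<lambda>i j. A $$ (i, j))"
    unfolding forest_pattern_def
  proof (intro allI impI)
    fix W assume W: "W \<subseteq> {0..<?n}" "W \<noteq> {}"
    then obtain w p where "w \<in> W" "\<forall>u\<in>W. (w, u) \<in> parcs G \<longrightarrow> u = p"
      using \<open>locally_leafy G\<close> unfolding locally_leafy_def pv by blast
    then show "\<exists>w\<in>W. \<exists>p. \<forall>u\<in>W. u \<noteq> w \<and> u \<noteq> p \<longrightarrow> A $$ (w, u) = 0"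
      using W A_zero by (intro bexI[of _ w] exI[of _ p]) (auto simp: subset_eq)
  qed
  then have "0 \<le> quad_form {0..<?n} (\<lambda>i j. f (A $$ (i, j))) x" for x
    using A_nonneg A_sym A_psd by (intro forest_entrywise_psd[OF f]) auto
  then have "0 \<le> quad_form {0..<?n} (\<lambda>i j. ?B $$ (i, j)) x" for x
    using B by (subst quad_form_cong[where b = "\<lambda>i j. f (A $$ (i, j))" and y = x]) auto
  moreover have "?B \<in> graph_sym_mats G UNIV"
  proof -
    have "transpose_mat ?B = ?B"
    proof (rule eq_matI)
      fix i j assume "i < dim_row ?B" "j < dim_col ?B"
      then have ij: "i < ?n" "j < ?n" by (auto simp: graph_entrywise_def)
      then have "transpose_mat ?B $$ (i, j) = ?B $$ (j, i)"
        by (intro index_transpose_mat) (auto simp: graph_entrywise_def)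
      then show "transpose_mat ?B $$ (i, j) = ?B $$ (i, j)"
        unfolding B[OF ij] B[OF ij(2,1)] A_sym[OF ij] .
    qed (auto simp: graph_entrywise_def)
    then show ?thesis
      by (auto simp: graph_sym_mats_def sym_mats_def graph_entrywise_def)
  qed
  ultimately show ?thesis
    by (auto simp: graph_psd_mats_def psd_mats_iff_quad_form graph_sym_mats_def)
qed

lemma successively_imp_zip_tl_subset:
  "successively (\<lambda>u v. (u, v) \<in> E) vs \<Longrightarrow> set (zip vs (tl vs)) \<subseteq> E"
  by (induction vs rule: induct_list012) auto

lemma pcas_consecutive:
  assumes "vs \<noteq> []"
  shows "pcas (hd vs) (zip vs (tl vs)) (last vs)" "pawalk_verts (hd vs) (zip vs (tl vs)) = vs"
  using assms by (induction vs rule: induct_list012) auto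

text \<open>
  If every vertex of \<open>W\<close> had two neighbours in \<open>W\<close>, take a longest path in \<open>W\<close>, starting at \<open>v\<close>. All
  neighbours of \<open>v\<close> in \<open>W\<close> lie on the path, for otherwise it could be prolonged; one of them, \<open>x\<close>,
  is not the second vertex, and closing the path at \<open>x\<close> gives a cycle of length at least three.
\<close>

lemma undirected_tree_locally_leafy:
  assumes T: "undirected_tree G"
  shows "locally_leafy G"
proof (rule ccontr)
  assume "\<not> locally_leafy G"
  then obtain W where W: "W \<subseteq> pverts G" "W \<noteq> {}"
    and branch: "\<And>w p. w \<in> W \<Longrightarrow> \<exists>u\<in>W. (w, u) \<in> parcs G \<and> u \<noteq> p"
    unfolding locally_leafy_def by meson
  interpret pair_graph G using T by (simp add: undirected_tree_def labelled_graph_def)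
  have symG: "(i, j) \<in> parcs G \<longleftrightarrow> (j, i) \<in> parcs G" for i j
    using pair_sym_arcs by (auto simp: symmetric_def dest: symD)
  have finW: "finite W" using W pair_finite_verts finite_subset by blast
  define path where "path vs \<longleftrightarrow> vs \<noteq> [] \<and> distinct vs \<and> set vs \<subseteq> W \<and> successively (\<lambda>u v. (u, v) \<in> parcs G) vs" for vs
  obtain w0 where "w0 \<in> W" using W by blast
  then have "path [w0]" by (simp add: path_def)
  moreover have "\<forall>vs. path vs \<longrightarrow> length vs < Suc (card W)"
    using finW by (auto simp: path_def less_Suc_eq_le distinct_card[symmetric] intro: card_mono)
  ultimately obtain vs where vs: "path vs" and max: "\<And>us. path us \<Longrightarrow> length us \<le> length vs"
    using ex_has_greatest_nat[of path "[w0]" length "Suc (card W)"] by auto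
  obtain v us where vs_eq: "vs = v # us" using vs by (cases vs) (auto simp: path_def)
  have vW: "v \<in> W" using vs by (auto simp: path_def vs_eq)
  \<comment> \<open>For a path with the single vertex \<open>v\<close>, \<open>hd us\<close> is an unspecified value; any neighbour of \<open>v\<close>
    then prolongs the path.\<close>
  obtain x where x: "x \<in> W" "(v, x) \<in> parcs G" "x \<noteq> hd us"
    using branch[OF vW] by metis
  have "\<not> path (x # vs)" using max[of "x # vs"] by auto
  then have "x \<in> set vs"
    using vs x symG by (auto simp: path_def vs_eq)
  moreover have "x \<noteq> v" using x pair_no_loops[of "(v, x)"] by auto
  ultimately have "x \<in> set us" by (simp add: vs_eq)
  then obtain ys zs where us: "us = ys @ x # zs" by (auto simp: in_set_conv_decomp)
  then have ys: "ys \<noteq> []" using x(3) by (cases ys) auto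
  define cs where "cs = x # v # ys @ [x]"
  define p where "p = zip cs (tl cs)"
  have "set p \<subseteq> parcs G"
  proof -
    have "successively (\<lambda>u v. (u, v) \<in> parcs G) ((v # ys @ [x]) @ zs)"
      using vs by (simp add: path_def vs_eq us)
    then have "successively (\<lambda>u v. (u, v) \<in> parcs G) (v # ys @ [x])"
      unfolding successively_append_iff by simp
    then have "successively (\<lambda>u v. (u, v) \<in> parcs G) cs"
      using x symG[of v x] by (simp add: cs_def)
    then show ?thesis
      unfolding p_def by (rule successively_imp_zip_tl_subset)
  qed
  moreover have "pcas x p x" and verts: "tl (pawalk_verts x p) = v # ys @ [x]"
    using pcas_consecutive[of cs] by (auto simp: p_def cs_def)
  moreover have "x \<in> pverts G" using x W by auto
  ultimately have "awalk x p x" by (simp add: awalk_def)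
  moreover have "distinct (tl (pawalk_verts x p))"
    unfolding verts using vs by (simp add: path_def vs_eq us)
  moreover have len: "3 \<le> length p" using ys by (cases ys) (auto simp: p_def cs_def)
  ultimately have "cycle p"
    unfolding cycle_def by (intro exI[of _ x]) auto
  with len have "\<exists>p. pre_digraph.cycle (with_proj G) p \<and> 3 \<le> length p"
    by (intro exI[of _ p] conjI)
  moreover from T[unfolded undirected_tree_def]
  have "\<not> (\<exists>p. pre_digraph.cycle (with_proj G) p \<and> 3 \<le> length p)"
    by (elim conjE)
  ultimately show False by (rule notE[rotated])
qed

definition star_graph :: "nat \<Rightarrow> nat pair_pre_digraph" where
  "star_graph n = \<lparr>pverts = {0..<Suc n}, parcs = {0} \<times> {1..n} \<union> {1..n} \<times> {0}\<rparr>"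

lemma star_graph_labelled: "labelled_graph (star_graph n)"
proof -
  have "pair_graph (star_graph n)"
    by unfold_locales (auto simp: star_graph_def symmetric_def intro!: symI)
  then show ?thesis
    unfolding labelled_graph_def by (auto simp: star_graph_def)
qed

lemma star_graph_locally_leafy: "locally_leafy (star_graph n)"
  unfolding locally_leafy_def
proof (intro allI impI)
  fix W :: "nat set" assume "W \<noteq> {}"
  show "\<exists>w\<in>W. \<exists>p. \<forall>u\<in>W. (w, u) \<in> parcs (star_graph n) \<longrightarrow> u = p"
  proof (cases "W = {0}")
    case True
    then show ?thesis by auto
  next
    case False
    then obtain w where "w \<in> W" "w \<noteq> 0" using \<open>W \<noteq> {}\<close> by auto
    then show ?thesis
      by (intro bexI[of _ w] exI[of _ 0]) (auto simp: star_graph_def)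
  qed
qed

lemma star_graph_max_degree: "n \<le> max_degree (star_graph n)"
proof -
  have "out_arcs (with_proj (star_graph n)) 0 = Pair 0 ` {1..n}"
    by (auto simp: out_arcs_def star_graph_def)
  then have "out_degree (with_proj (star_graph n)) 0 = n"
    by (simp add: out_degree_def card_image inj_on_def)
  moreover have "out_degree (with_proj (star_graph n)) 0
      \<le> Max (out_degree (with_proj (star_graph n)) ` pverts (star_graph n))"
    by (intro Max_ge) (auto simp: star_graph_def)
  ultimately show ?thesis by (simp add: max_degree_def)
qed

section \<open>The preserver\<close>

lemma enat_unbounded_infinity:
  assumes "\<And>N. enat N \<le> x"
  shows "x = \<infinity>"
proof (cases x)
  case (enat k)
  then show ?thesis using assms[of "Suc k"] by simp
qed simp

definition gap_series :: "complex \<Rightarrow> complex" where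
  "gap_series z = (\<Sum>n. complex_of_real (gap_coeff n) * z ^ n)"

lemma gap_series_sums: "(\<lambda>n. complex_of_real (gap_coeff n) * z ^ n) sums gap_series z"
  unfolding gap_series_def by (rule summable_sums[OF summable_gap_coeff])

lemma gap_series_of_real:
  "gap_series (complex_of_real x) = complex_of_real (\<Sum>n. gap_coeff n * x ^ n)"
  using suminf_of_real[of "\<lambda>n. gap_coeff n * x ^ n", where 'a = complex] summable_gap_coeff[of x]
  by (simp add: gap_series_def)

lemma gap_series_analytic: "gap_series analytic_on UNIV"
proof -
  have "gap_series holomorphic_on UNIV"
    unfolding gap_series_def holomorphic_on_def field_differentiable_def
    using termdiffs_strong_converges_everywhere[OF summable_gap_coeff] by blast
  then show ?thesis by (simp add: analytic_on_open)
qed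

lemma gap_series_not_absolutely_monotonic:
  "\<not> absolutely_monotonic_on {0..} (\<lambda>x. Re (gap_series (complex_of_real x)))"
proof -
  obtain m where "gap_coeff m < 0"
    using gap_coeff_negative_strings[of 1] by auto
  moreover have "summable (\<lambda>n. gap_coeff n * x ^ n)" for x :: real
    using summable_gap_coeff[of x] by simp
  ultimately obtain x where x: "x > 0" "(deriv ^^ m) (\<lambda>x. \<Sum>n. gap_coeff n * x ^ n) x < 0"
    using negative_coeff_not_absolutely_monotonic by blast
  have real: "(\<lambda>x. Re (gap_series (complex_of_real x))) = (\<lambda>x. \<Sum>n. gap_coeff n * x ^ n)"
    by (simp only: gap_series_of_real Re_complex_of_real)
  show ?thesis
  proof
    assume "absolutely_monotonic_on {0..} (\<lambda>x. Re (gap_series (complex_of_real x)))"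
    then have "\<forall>x\<in>{0<..}. 0 \<le> (deriv ^^ m) (\<lambda>x. \<Sum>n. gap_coeff n * x ^ n) x"
      unfolding absolutely_monotonic_on_def real interior_real_atLeast by (elim conjE) (rule spec)
    then show False using x by (meson greaterThan_iff not_le)
  qed
qed

lemma gap_series_preserves_psd:
  assumes "labelled_graph G" "locally_leafy G" "A \<in> graph_psd_mats G {0..}"
  shows "graph_entrywise G (\<lambda>x. Re (gap_series (complex_of_real x))) A \<in> graph_psd_mats G UNIV"
  using graph_entrywise_psd[OF gap_series_mult_convex_superadditive assms]
  by (simp add: gap_series_of_real)

theorem theoremB:
  shows
    "(\<exists>(a :: nat \<Rightarrow> real) (f :: complex \<Rightarrow> complex).
        f analytic_on UNIV \<and>
        (\<forall>z. (\<lambda>n. complex_of_real (a n) * z ^ n) sums f z) \<and>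
        (\<forall>n. a n \<in> {-1..1}) \<and>
        (\<forall>L. \<exists>m. \<forall>k<L. a (m + k) < 0) \<and>
        (\<forall>G. undirected_tree G \<longrightarrow>
           (\<forall>A \<in> graph_psd_mats G {0..}.
              graph_entrywise G (\<lambda>x. Re (f (complex_of_real x))) A \<in> graph_psd_mats G UNIV)))
     \<and>
     (\<exists>(G :: nat \<Rightarrow> nat pair_pre_digraph) (f :: complex \<Rightarrow> complex).
        (\<forall>n\<ge>1. labelled_graph (G n)) \<and>
        f analytic_on UNIV \<and>
        (\<forall>x\<in>{0..}. f (complex_of_real x) \<in> \<real>) \<and>
        \<not> absolutely_monotonic_on {0..} (\<lambda>x. Re (f (complex_of_real x))) \<and>
        (SUP n\<in>{1..}. enat (max_degree (G n))) = \<infinity> \<and>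
        (\<forall>n\<ge>1. \<forall>A \<in> graph_psd_mats (G n) {0..}.
           graph_entrywise (G n) (\<lambda>x. Re (f (complex_of_real x))) A \<in> graph_psd_mats (G n) UNIV))"
proof
  have bound: "gap_coeff n \<in> {-1..1}" for n
  proof -
    have "\<bar>gap_coeff n\<bar> \<le> 1"
      by (rule order_trans[OF abs_gap_coeff_le]) simp
    then show ?thesis by (simp add: abs_le_iff)
  qed
  have tree: "graph_entrywise G (\<lambda>x. Re (gap_series (complex_of_real x))) A \<in> graph_psd_mats G UNIV"
    if "undirected_tree G" "A \<in> graph_psd_mats G {0..}" for G A
  proof (rule gap_series_preserves_psd)
    show "labelled_graph G" using that(1)[unfolded undirected_tree_def] by (elim conjE)
    show "locally_leafy G" using that(1) by (rule undirected_tree_locally_leafy)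
  qed (rule that(2))
  show "\<exists>(a :: nat \<Rightarrow> real) (f :: complex \<Rightarrow> complex).
        f analytic_on UNIV \<and>
        (\<forall>z. (\<lambda>n. complex_of_real (a n) * z ^ n) sums f z) \<and>
        (\<forall>n. a n \<in> {-1..1}) \<and>
        (\<forall>L. \<exists>m. \<forall>k<L. a (m + k) < 0) \<and>
        (\<forall>G. undirected_tree G \<longrightarrow>
           (\<forall>A \<in> graph_psd_mats G {0..}.
              graph_entrywise G (\<lambda>x. Re (f (complex_of_real x))) A \<in> graph_psd_mats G UNIV))"
    by (rule exI[of _ gap_coeff], rule exI[of _ gap_series], intro conjI allI ballI impI)
      (fact gap_series_analytic gap_series_sums bound gap_coeff_negative_strings
        | erule (1) tree)+
  have "enat N \<le> (SUP n\<in>{1..}. enat (max_degree (star_graph n)))" for N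
  proof -
    have "enat N \<le> enat (max_degree (star_graph (Suc N)))"
      using star_graph_max_degree[of "Suc N"] by simp
    also have "\<dots> \<le> (SUP n\<in>{1..}. enat (max_degree (star_graph n)))"
      by (rule SUP_upper) simp
    finally show ?thesis .
  qed
  then have unbounded: "(SUP n\<in>{1..}. enat (max_degree (star_graph n))) = \<infinity>"
    by (intro enat_unbounded_infinity)
  show "\<exists>(G :: nat \<Rightarrow> nat pair_pre_digraph) (f :: complex \<Rightarrow> complex).
        (\<forall>n\<ge>1. labelled_graph (G n)) \<and>
        f analytic_on UNIV \<and>
        (\<forall>x\<in>{0..}. f (complex_of_real x) \<in> \<real>) \<and>
        \<not> absolutely_monotonic_on {0..} (\<lambda>x. Re (f (complex_of_real x))) \<and>
        (SUP n\<in>{1..}. enat (max_degree (G n))) = \<infinity> \<and>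
        (\<forall>n\<ge>1. \<forall>A \<in> graph_psd_mats (G n) {0..}.
           graph_entrywise (G n) (\<lambda>x. Re (f (complex_of_real x))) A \<in> graph_psd_mats (G n) UNIV)"
  proof (rule exI[of _ star_graph], rule exI[of _ gap_series], intro conjI allI ballI impI)
    show "gap_series (complex_of_real x) \<in> \<real>" for x
      by (simp add: gap_series_of_real)
    show "graph_entrywise (star_graph n) (\<lambda>x. Re (gap_series (complex_of_real x))) A
        \<in> graph_psd_mats (star_graph n) UNIV"
      if "A \<in> graph_psd_mats (star_graph n) {0..}" for n A
      using star_graph_labelled star_graph_locally_leafy that by (rule gap_series_preserves_psd)
  qed (rule star_graph_labelled gap_series_analytic gap_series_not_absolutely_monotonic unbounded)+
qed

end
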